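(* Consider the relaxed regulator's problem (R) described in the context with $K=\infty$, and let $(a^\circ,c^\circ)$ be an optimal solution. (1) If $t(\alpha,u)=\alpha$, then there exists a threshold $u_\infty\le v$ such that $$a^\circ(\alpha,u)=\begin{cases}1&\text{if }u<u_\infty,\\0&\text{if }u\ge u_\infty,\end{cases}$$ and the threshold is given by $$u_\infty:=v-\int_0^vF(\alpha)\,d\alpha=v(1-F(v))+\mathbb E[\alpha\mid\alpha<v]\,F(v).$$ (2) If $t(\alpha,u)=\alpha u$, both $f$ and $g$ are uniform densities, and $\bar\alpha>2$, then the threshold (for which $a^\circ(\alpha,u)=1$ if $u<u_\infty$ and $a^\circ(\alpha,u)=0$ if $u\ge u_\infty$) is $$u_\infty=\frac v2\left(1+\sqrt{1-\frac2{\bar\alpha}}\right).$$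
   Context: Fix $\bar\alpha,\bar u>0$, $v>0$. The types $\alpha\in[0,\bar\alpha]$ and $u\in[0,\bar u]$ are independent with densities $f$ on $[0,\bar\alpha]$ and $g$ on $[0,\bar u]$, positive and continuous on these intervals (zero outside), with c.d.f.s $F$ and $G$. $r(u):=\frac{1-G(u)}{g(u)}-u$ is assumed decreasing in $u$. Problem (R), with inspection cost $K$: over functions $a,c:[0,\bar\alpha]\times[0,\bar u]\to[0,1]$, maximize $$\int_0^{\bar u} g(u)\int_0^{\bar\alpha} f(\alpha)\big(\min(v,t(\alpha,u))-u\big)a(\alpha,u)\,d\alpha\,du$$ subject to (budget) $\int_0^{\bar u}g(u)\int_0^{\bar\alpha}f(\alpha)\Big(\int_0^u a(\alpha,x)\,dx-u\,a(\alpha,u)\Big)d\alpha\,du\ \ge\ K\int_0^{\bar u}g(u)\int_0^{\bar\alpha}f(\alpha)c(\alpha,u)\,d\alpha\,du$; $a(\alpha,u)-a(\alpha,u)c(\alpha,u)\le a(0,u)$ for all $\alpha,u$; $c(\alpha,u)\le a(\alpha,u)$ for all $\alpha,u$; $a(\alpha,u)\le a(\alpha,u')$ for all $\alpha$ and all $u\ge u'$; $a(0,u)\le a(\alpha,u)$ for all $\alpha,u$. The case $K=\infty$ means that the budget constraint forces $c(\alpha,u)=0$ for all $(\alpha,u)$.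
   Formalization: An optimal solution is only pinned down off a null set, so the threshold form is shown for every optimal solution at all types except u = u_∞ and, if ū < u_∞, u = ū; in addition the exact threshold rule with c = 0 is shown to be optimal. *)

theory Defs
  imports "HOL-Probability.Probability"
begin

text \<open>
  A decision rule is a pair \<open>a\<close>, \<open>c\<close> of functions of the type \<open>(\<alpha>, u)\<close>; only its values on
  \<open>{0..abar} \<times> {0..ubar}\<close> matter.  Independence of the two types is built into the product
  density \<open>f \<alpha> * g u\<close> against which everything is integrated.
\<close>

definition law :: "(real \<Rightarrow> real) \<Rightarrow> real measure" where
  "law f = density lborel (\<lambda>x. ennreal (f x))"

text \<open>
  Positivity and continuity are only required on the interval, so \<open>f\<close> may jump at its ends.
\<close>

definition type_density :: "real \<Rightarrow> (real \<Rightarrow> real) \<Rightarrow> bool" where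
  "type_density b f \<longleftrightarrow>
     continuous_on {0..b} f \<and> (\<forall>x\<in>{0..b}. 0 < f x) \<and> (\<forall>x. x \<notin> {0..b} \<longrightarrow> f x = 0) \<and>
     prob_space (law f)"

definition mean_below :: "(real \<Rightarrow> real) \<Rightarrow> real \<Rightarrow> real" where
  "mean_below f v = (LINT x|uniform_measure (law f) {..<v}. x)"

definition welfare ::
  "real \<Rightarrow> real \<Rightarrow> (real \<Rightarrow> real) \<Rightarrow> (real \<Rightarrow> real) \<Rightarrow> real \<Rightarrow> (real \<Rightarrow> real \<Rightarrow> real)
    \<Rightarrow> (real \<Rightarrow> real \<Rightarrow> real) \<Rightarrow> real" where
  "welfare abar ubar f g v t a =
     (LINT u:{0..ubar}|lborel. g u *
       (LINT \<alpha>:{0..abar}|lborel. f \<alpha> * ((min v (t \<alpha> u) - u) * a \<alpha> u)))"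

definition revenue ::
  "real \<Rightarrow> real \<Rightarrow> (real \<Rightarrow> real) \<Rightarrow> (real \<Rightarrow> real) \<Rightarrow> (real \<Rightarrow> real \<Rightarrow> real) \<Rightarrow> real" where
  "revenue abar ubar f g a =
     (LINT u:{0..ubar}|lborel. g u *
       (LINT \<alpha>:{0..abar}|lborel. f \<alpha> * ((LINT x:{0..u}|lborel. a \<alpha> x) - u * a \<alpha> u)))"

definition inspections ::
  "real \<Rightarrow> real \<Rightarrow> (real \<Rightarrow> real) \<Rightarrow> (real \<Rightarrow> real) \<Rightarrow> (real \<Rightarrow> real \<Rightarrow> real) \<Rightarrow> real" where
  "inspections abar ubar f g c =
     (LINT u:{0..ubar}|lborel. g u * (LINT \<alpha>:{0..abar}|lborel. f \<alpha> * c \<alpha> u))"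

text \<open>
  Since \<open>\<infinity> * 0 = 0\<close> in \<^typ>\<open>ereal\<close>, the displayed inequality with \<open>K = \<infinity>\<close> says that the expected
  number of inspections is zero and the revenue nonnegative.  The convention for \<open>K = \<infinity>\<close> is that
  \<open>c\<close> vanishes at every type, not just at almost every type, whence the extra conjunct.
\<close>

definition budget ::
  "real \<Rightarrow> real \<Rightarrow> (real \<Rightarrow> real) \<Rightarrow> (real \<Rightarrow> real) \<Rightarrow> ereal
    \<Rightarrow> (real \<Rightarrow> real \<Rightarrow> real) \<Rightarrow> (real \<Rightarrow> real \<Rightarrow> real) \<Rightarrow> bool" where
  "budget abar ubar f g K a c \<longleftrightarrow>
     ereal (revenue abar ubar f g a) \<ge> K * ereal (inspections abar ubar f g c) \<and>
     (K = \<infinity> \<longrightarrow> (\<forall>\<alpha>\<in>{0..abar}. \<forall>u\<in>{0..ubar}. c \<alpha> u = 0))"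

text \<open>Joint measurability is implicit in writing the integrals.\<close>

definition feasible ::
  "real \<Rightarrow> real \<Rightarrow> (real \<Rightarrow> real) \<Rightarrow> (real \<Rightarrow> real) \<Rightarrow> ereal
    \<Rightarrow> (real \<Rightarrow> real \<Rightarrow> real) \<Rightarrow> (real \<Rightarrow> real \<Rightarrow> real) \<Rightarrow> bool" where
  "feasible abar ubar f g K a c \<longleftrightarrow>
     (\<lambda>(\<alpha>, u). a \<alpha> u) \<in> borel_measurable (restrict_space borel ({0..abar} \<times> {0..ubar})) \<and>
     (\<lambda>(\<alpha>, u). c \<alpha> u) \<in> borel_measurable (restrict_space borel ({0..abar} \<times> {0..ubar})) \<and>
     (\<forall>\<alpha>\<in>{0..abar}. \<forall>u\<in>{0..ubar}. a \<alpha> u \<in> {0..1} \<and> c \<alpha> u \<in> {0..1}) \<and>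
     budget abar ubar f g K a c \<and>
     (\<forall>\<alpha>\<in>{0..abar}. \<forall>u\<in>{0..ubar}. a \<alpha> u - a \<alpha> u * c \<alpha> u \<le> a 0 u) \<and>
     (\<forall>\<alpha>\<in>{0..abar}. \<forall>u\<in>{0..ubar}. c \<alpha> u \<le> a \<alpha> u) \<and>
     (\<forall>\<alpha>\<in>{0..abar}. \<forall>u\<in>{0..ubar}. \<forall>u'\<in>{0..ubar}. u \<ge> u' \<longrightarrow> a \<alpha> u \<le> a \<alpha> u') \<and>
     (\<forall>\<alpha>\<in>{0..abar}. \<forall>u\<in>{0..ubar}. a 0 u \<le> a \<alpha> u)"

definition optimal ::
  "real \<Rightarrow> real \<Rightarrow> (real \<Rightarrow> real) \<Rightarrow> (real \<Rightarrow> real) \<Rightarrow> real \<Rightarrow> (real \<Rightarrow> real \<Rightarrow> real) \<Rightarrow> ereal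
    \<Rightarrow> (real \<Rightarrow> real \<Rightarrow> real) \<Rightarrow> (real \<Rightarrow> real \<Rightarrow> real) \<Rightarrow> bool" where
  "optimal abar ubar f g v t K a c \<longleftrightarrow>
     feasible abar ubar f g K a c \<and>
     (\<forall>a' c'. feasible abar ubar f g K a' c' \<longrightarrow>
        welfare abar ubar f g v t a' \<le> welfare abar ubar f g v t a)"

definition threshold_rule :: "real \<Rightarrow> real \<Rightarrow> real \<Rightarrow> real" where
  "threshold_rule w \<alpha> u = (if u < w then 1 else 0)"

text \<open>
  Optimality cannot see a change of \<open>a\<close> on a null set of types.  Monotonicity in \<open>u\<close> leaves just two
  values of \<open>u\<close> at which an optimal \<open>a\<close> may differ from the threshold rule: \<open>u = w\<close>, and \<open>u = ubar\<close>
  if \<open>ubar < w\<close>.  Elsewhere the agreement is pointwise.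
\<close>

definition follows_threshold :: "real \<Rightarrow> real \<Rightarrow> real \<Rightarrow> (real \<Rightarrow> real \<Rightarrow> real) \<Rightarrow> bool" where
  "follows_threshold abar ubar w a \<longleftrightarrow>
     (\<forall>\<alpha>\<in>{0..abar}. \<forall>u\<in>{0..ubar}.
        (u < w \<and> u \<noteq> ubar \<longrightarrow> a \<alpha> u = 1) \<and> (u > w \<longrightarrow> a \<alpha> u = 0))"

end

theory Submission
  imports Defs
begin

text \<open>
  With \<open>K = \<infinity>\<close> there are no inspections, so the two constraints comparing \<open>a \<alpha> u\<close> with \<open>a 0 u\<close>
  force \<open>a \<alpha> u = b u\<close> for a decreasing \<open>b\<close>, and then the budget constraint holds by itself because
  \<open>u * b u\<close> is at most the integral of \<open>b\<close> over \<open>{0..u}\<close>.  The objective becomes the integral of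
  \<open>g * \<phi> * b\<close>, where \<open>\<phi> u = E[min v (t \<alpha> u)] - u\<close>.  If \<open>\<phi>\<close> changes sign from \<open>+\<close> to \<open>-\<close> at \<open>w\<close>,
  the indicator of \<open>u < w\<close> maximizes the integrand pointwise; another maximizer \<open>b\<close> agrees with it
  almost everywhere, hence by monotonicity everywhere except at \<open>w\<close> and at the right end point.

  For \<open>t \<alpha> u = \<alpha>\<close> the sign change of \<open>\<phi>\<close> is at \<open>E[min v \<alpha>]\<close>.  For \<open>t \<alpha> u = \<alpha> * u\<close> and uniform
  densities \<open>\<phi>\<close> is linear and positive on \<open>0 < u \<le> v / abar\<close>; beyond that, \<open>u * \<phi> u\<close> is a quadratic
  whose smaller root lies below \<open>v / abar\<close> and whose larger root is the threshold.
\<close>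

section \<open>Pointwise maximization over decreasing functions on an interval\<close>

text \<open>An open interval of positive length is not contained in a null set. This supplies the
  sample points at which an almost-everywhere identity can be combined with monotonicity.\<close>

lemma AE_lborel_obtain_Ioo:
  fixes x y :: real
  assumes "AE z in lborel. P z" and "x < y"
  obtains z where "x < z" "z < y" "P z"
proof (rule ccontr)
  assume *: "\<not> thesis"
  obtain N where N: "{z. \<not> P z} \<subseteq> N" "emeasure lborel N = 0" "N \<in> sets lborel"
    using assms(1) by (auto elim: AE_E)
  have "{x<..<y} \<subseteq> N"
    using * that N(1) by fastforce
  then have "emeasure lborel {x<..<y} \<le> emeasure lborel N"
    using N(3) by (intro emeasure_mono)
  then show False
    using N(2) \<open>x < y\<close> by simp
qed

text \<open>Monotonicity supplies the measurability of \<open>b\<close>, and since \<open>b\<close>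
  has values in \<open>{0..1}\<close> the product is dominated by \<open>h\<close>.\<close>

lemma set_integrable_antimono_mult:
  fixes b h :: "real \<Rightarrow> real"
  assumes h: "set_integrable lborel {0..B} h"
    and b: "\<And>u. u \<in> {0..B} \<Longrightarrow> b u \<in> {0..1}"
    and anti: "antimono_on {0..B} b"
  shows "set_integrable lborel {0..B} (\<lambda>u. b u * h u)"
proof (rule set_integrable_bound[OF h])
  have "mono_on {0..B} (\<lambda>u. - b u)"
    using anti by (auto simp: monotone_on_def)
  then have "(\<lambda>u. - (- b u)) \<in> borel_measurable (restrict_space borel {0..B})"
    by (intro borel_measurable_uminus borel_measurable_mono_on_fnc)
  then have "(\<lambda>u. indicator {0..B} u *\<^sub>R b u) \<in> borel_measurable borel"
    by (simp add: borel_measurable_restrict_space_iff)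
  moreover have "(\<lambda>u. indicator {0..B} u *\<^sub>R h u) \<in> borel_measurable borel"
    using h by (auto simp: set_integrable_def)
  ultimately have "(\<lambda>u. (indicator {0..B} u *\<^sub>R b u) * (indicator {0..B} u *\<^sub>R h u)) \<in> borel_measurable borel"
    by (rule borel_measurable_times)
  also have "(\<lambda>u. (indicator {0..B} u *\<^sub>R b u) * (indicator {0..B} u *\<^sub>R h u))
      = (\<lambda>u. indicator {0..B} u *\<^sub>R (b u * h u))"
    by (auto simp: indicator_def)
  finally show "set_borel_measurable lborel {0..B} (\<lambda>u. b u * h u)"
    by (simp add: set_borel_measurable_def)
  have "\<bar>b u\<bar> * \<bar>h u\<bar> \<le> \<bar>h u\<bar>" if "u \<in> {0..B}" for u
    using b[OF that] by (intro mult_left_le_one_le) auto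
  then show "AE u in lborel. u \<in> {0..B} \<longrightarrow> norm (b u * h u) \<le> norm (h u)"
    by (auto simp: abs_mult)
qed

text \<open>The signs of \<open>h\<close> make the loss of \<open>b\<close> against the threshold
  function nonnegative almost everywhere, so a maximizer has zero loss almost everywhere. The sign
  is not prescribed at \<open>u = 0\<close> because the surplus vanishes there when
  \<open>t \<alpha> u = \<alpha> * u\<close>.\<close>

lemma bang_bang:
  fixes b h :: "real \<Rightarrow> real"
  assumes h: "set_integrable lborel {0..B} h"
    and pos: "\<And>u. 0 < u \<Longrightarrow> u \<le> B \<Longrightarrow> u < w \<Longrightarrow> 0 < h u"
    and neg: "\<And>u. w < u \<Longrightarrow> u \<le> B \<Longrightarrow> h u < 0"
    and w: "0 \<le> w"
    and b: "\<And>u. u \<in> {0..B} \<Longrightarrow> b u \<in> {0..1}"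
    and anti: "antimono_on {0..B} b"
  shows bang_bang_le: "(LINT u:{0..B}|lborel. b u * h u)
      \<le> (LINT u:{0..B}|lborel. (if u < w then 1 else 0) * h u)"
    and bang_bang_unique: "(LINT u:{0..B}|lborel. (if u < w then 1 else 0) * h u)
        \<le> (LINT u:{0..B}|lborel. b u * h u) \<Longrightarrow> u \<in> {0..B} \<Longrightarrow>
      (u < w \<and> u \<noteq> B \<longrightarrow> b u = 1) \<and> (u > w \<longrightarrow> b u = 0)"
proof -
  let ?L = "LINT u:{0..B}|lborel. b u * h u"
  let ?R = "LINT u:{0..B}|lborel. (if u < w then 1 else 0) * h u"
  define s where "s = (\<lambda>u. if u < w then 1 else 0 :: real)"
  \<comment> \<open>The pointwise loss of \<open>b\<close> relative to the threshold function
    \<open>s\<close>, extended by zero outside \<open>{0..B}\<close>.\<close>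
  define D where "D = (\<lambda>u. indicator {0..B} u *\<^sub>R (s u * h u) - indicator {0..B} u *\<^sub>R (b u * h u))"
  have ib: "set_integrable lborel {0..B} (\<lambda>u. b u * h u)"
    using h b anti by (rule set_integrable_antimono_mult)
  have s_int: "set_integrable lborel {0..B} (\<lambda>u. s u * h u)"
    using h by (rule set_integrable_antimono_mult) (auto simp: s_def monotone_on_def)
  have iD: "integrable lborel D"
    using ib s_int unfolding D_def set_integrable_def by auto
  have D: "integral\<^sup>L lborel D = ?R - ?L"
    using ib s_int unfolding D_def set_integrable_def set_lebesgue_integral_def
    by (subst Bochner_Integration.integral_diff) (auto simp: s_def)
  \<comment> \<open>Nothing is known about the sign of \<open>h\<close> at \<open>0\<close> and
    \<open>w\<close>; these two points form a null set.\<close>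
  have D_nn: "0 \<le> D u" if "u \<noteq> 0" "u \<noteq> w" for u
  proof (cases "u \<in> {0..B}")
    case True
    consider "u < w" | "w < u" using \<open>u \<noteq> w\<close> by linarith
    then show ?thesis
    proof cases
      case 1
      have "0 \<le> (1 - b u) * h u"
        using pos[of u] b[OF True] True that 1 by (intro mult_nonneg_nonneg) auto
      then show ?thesis using True 1 by (simp add: D_def s_def algebra_simps)
    next
      case 2
      have "0 \<le> b u * (- h u)"
        using neg[of u] b[OF True] True that 2 by (intro mult_nonneg_nonneg) auto
      then show ?thesis using True 2 by (simp add: D_def s_def algebra_simps)
    qed
  qed (simp add: D_def)
  have AE_nn: "AE u in lborel. 0 \<le> D u"
    using AE_lborel_singleton[of 0] AE_lborel_singleton[of w] by eventually_elim (rule D_nn)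
  show "?L \<le> ?R"
    using integral_nonneg_AE[OF AE_nn] D by simp
  assume "?R \<le> ?L" and u: "u \<in> {0..B}"
  then have "integral\<^sup>L lborel D = 0"
    using integral_nonneg_AE[OF AE_nn] D by simp
  then have AE0: "AE u in lborel. D u = 0"
    using integral_nonneg_eq_0_iff_AE[OF iD AE_nn] by simp
  show "(u < w \<and> u \<noteq> B \<longrightarrow> b u = 1) \<and> (u > w \<longrightarrow> b u = 0)"
  proof (intro conjI impI; (elim conjE)?)
    assume "u < w" "u \<noteq> B"
    \<comment> \<open>The interval above \<open>u\<close> is nonempty because
      \<open>u \<noteq> B\<close>. At such a \<open>z\<close> zero loss and \<open>0 < h z\<close>
      give \<open>b z = 1\<close>, which monotonicity carries down to \<open>u\<close>.\<close>
    then obtain z where z: "u < z" "z < min w B" "D z = 0"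
      using AE_lborel_obtain_Ioo[OF AE0, of u "min w B"] u by auto
    then have "b z = 1"
      using pos[of z] u by (auto simp: D_def s_def)
    moreover have "b z \<le> b u"
      using anti u z by (auto simp: monotone_on_def)
    ultimately show "b u = 1"
      using b[OF u] by auto
  next
    assume "u > w"
    \<comment> \<open>The mirror image: a zero of \<open>b\<close> to the left of \<open>u\<close>
      is carried up to \<open>u\<close>. Here \<open>0 \<le> w\<close> keeps \<open>z\<close> inside
      \<open>{0..B}\<close>.\<close>
    then obtain z where z: "w < z" "z < u" "D z = 0"
      using AE_lborel_obtain_Ioo[OF AE0, of w u] u by auto
    then have "b z = 0"
      using neg[of z] u w by (auto simp: D_def s_def)
    moreover have "b u \<le> b z"
      using anti u z w by (auto simp: monotone_on_def)
    ultimately show "b u = 0"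
      using b[OF u] by auto
  qed
qed

section \<open>Reduction to one variable when inspections are excluded\<close>

lemma feasible_infinity_eq:
  assumes "feasible abar ubar f g \<infinity> a c" and "\<alpha> \<in> {0..abar}" and "u \<in> {0..ubar}"
  shows "a \<alpha> u = a 0 u"
proof -
  have "c \<alpha> u = 0" and "a \<alpha> u - a \<alpha> u * c \<alpha> u \<le> a 0 u" and "a 0 u \<le> a \<alpha> u"
    using assms by (auto simp: feasible_def budget_def)
  then show ?thesis by simp
qed

lemma welfare_feasible_infinity:
  assumes "feasible abar ubar f g \<infinity> a c"
  shows "welfare abar ubar f g v t a = (LINT u:{0..ubar}|lborel. a 0 u *
    (g u * (LINT \<alpha>:{0..abar}|lborel. f \<alpha> * (min v (t \<alpha> u) - u))))"
  unfolding welfare_def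
proof (rule set_lebesgue_integral_cong; (intro allI impI)?)
  fix u :: real
  assume u: "u \<in> {0..ubar}"
  have "(LINT \<alpha>:{0..abar}|lborel. f \<alpha> * ((min v (t \<alpha> u) - u) * a \<alpha> u))
    = (LINT \<alpha>:{0..abar}|lborel. a 0 u * (f \<alpha> * (min v (t \<alpha> u) - u)))"
  proof (rule set_lebesgue_integral_cong; (intro allI impI)?)
    fix \<alpha> assume "\<alpha> \<in> {0..abar}"
    then show "f \<alpha> * ((min v (t \<alpha> u) - u) * a \<alpha> u) = a 0 u * (f \<alpha> * (min v (t \<alpha> u) - u))"
      using feasible_infinity_eq[OF assms, of \<alpha> u] u by simp
  qed simp
  then show "g u * (LINT \<alpha>:{0..abar}|lborel. f \<alpha> * ((min v (t \<alpha> u) - u) * a \<alpha> u))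
    = a 0 u * (g u * (LINT \<alpha>:{0..abar}|lborel. f \<alpha> * (min v (t \<alpha> u) - u)))"
    by simp
qed simp

lemma type_density_nonneg: "type_density b f \<Longrightarrow> 0 \<le> f x"
  by (cases "x \<in> {0..b}") (auto simp: type_density_def less_imp_le)

lemma type_density_measurable:
  assumes "type_density b f"
  shows "f \<in> borel_measurable borel"
proof -
  have "(\<lambda>x. indicator {0..b} x *\<^sub>R f x) \<in> borel_measurable borel"
    using assms by (intro borel_measurable_continuous_on_indicator) (auto simp: type_density_def)
  also have "(\<lambda>x. indicator {0..b} x *\<^sub>R f x) = f"
    using assms by (auto simp: type_density_def indicator_def fun_eq_iff)
  finally show ?thesis .
qed

text \<open>Without inspections the right-hand side of the budget is
  \<open>\<infinity> * 0 = 0\<close>, so the budget asks for nonnegative revenue. The rule ignores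
  \<open>\<alpha>\<close> and decreases in \<open>u\<close>, which settles the other
  constraints.\<close>

lemma feasible_threshold_rule:
  assumes f: "type_density abar f" and g: "type_density ubar g"
  shows "feasible abar ubar f g \<infinity> (threshold_rule w) (\<lambda>_ _. 0)"
proof -
  have meas: "(\<lambda>(\<alpha>, u). threshold_rule w \<alpha> u) \<in> borel_measurable (restrict_space borel X)" for X
  proof -
    have "open {x :: real \<times> real. snd x < w}"
      by (intro open_Collect_less continuous_intros)
    then have "(indicator {x. snd x < w} :: real \<times> real \<Rightarrow> real) \<in> borel_measurable borel"
      by (intro borel_measurable_indicator) auto
    also have "indicator {x. snd x < w} = (\<lambda>(\<alpha>, u). threshold_rule w \<alpha> u)"
      by (auto simp: threshold_rule_def indicator_def fun_eq_iff)
    finally show ?thesis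
      by (rule measurable_restrict_space1)
  qed
  \<comment> \<open>the budget is free: an allocation decreasing in \<open>u\<close> makes the integrand of the revenue nonnegative\<close>
  have "0 \<le> (LINT x:{0..u}|lborel. threshold_rule w \<alpha> x) - u * threshold_rule w \<alpha> u"
    if "0 \<le> u" for \<alpha> u
  proof (cases "u < w")
    case True
    then have "(LINT x:{0..u}|lborel. threshold_rule w \<alpha> x) = (LINT x:{0..u}|lborel. 1)"
      by (intro set_lebesgue_integral_cong) (auto simp: threshold_rule_def)
    also have "\<dots> = u"
      using that by (simp add: set_lebesgue_integral_def)
    finally show ?thesis using True by (simp add: threshold_rule_def)
  next
    case False
    have "0 \<le> (LINT x:{0..u}|lborel. threshold_rule w \<alpha> x)"
      unfolding set_lebesgue_integral_def
      by (intro integral_nonneg_AE) (auto simp: threshold_rule_def)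
    then show ?thesis using False by (simp add: threshold_rule_def)
  qed
  then have "0 \<le> (LINT \<alpha>:{0..abar}|lborel.
      f \<alpha> * ((LINT x:{0..u}|lborel. threshold_rule w \<alpha> x) - u * threshold_rule w \<alpha> u))"
    if "0 \<le> u" for u
    unfolding set_lebesgue_integral_def[of _ "{0..abar}"] using that
    by (intro integral_nonneg_AE AE_I2 scaleR_nonneg_nonneg mult_nonneg_nonneg
        type_density_nonneg[OF f]) auto
  then have "0 \<le> revenue abar ubar f g (threshold_rule w)"
    unfolding revenue_def set_lebesgue_integral_def[of _ "{0..ubar}"]
    using type_density_nonneg[OF g]
    by (intro integral_nonneg_AE AE_I2) (auto simp: indicator_def simp del: mult_le_0_iff)
  then show ?thesis
    using meas by (auto simp: feasible_def budget_def inspections_def threshold_rule_def)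
qed

text \<open>Common core of both cases, which differ only in the surplus \<open>\<phi>\<close>.
  Feasibility of the threshold rule gives the inequality needed for uniqueness in
  \<open>bang_bang\<close>; its upper bound, applied to every feasible rule, gives optimality of the
  threshold rule itself.\<close>

lemma optimal_threshold:
  fixes f g :: "real \<Rightarrow> real" and abar v :: real and t :: "real \<Rightarrow> real \<Rightarrow> real"
  defines "\<phi> \<equiv> \<lambda>u. LINT \<alpha>:{0..abar}|lborel. f \<alpha> * (min v (t \<alpha> u) - u)"
  assumes "0 < abar" and f: "type_density abar f" and g: "type_density ubar g"
    and opt: "optimal abar ubar f g v t \<infinity> a c"
    and w: "0 \<le> w"
    and cont: "continuous_on {0..ubar} \<phi>"
    and pos: "\<And>u. 0 < u \<Longrightarrow> u \<le> ubar \<Longrightarrow> u < w \<Longrightarrow> 0 < \<phi> u"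
    and neg: "\<And>u. w < u \<Longrightarrow> u \<le> ubar \<Longrightarrow> \<phi> u < 0"
  shows "follows_threshold abar ubar w a \<and>
    optimal abar ubar f g v t \<infinity> (threshold_rule w) (\<lambda>_ _. 0)"
proof -
  define h where "h u = g u * \<phi> u" for u
  have g_pos: "0 < g u" if "u \<in> {0..ubar}" for u
    using g that by (auto simp: type_density_def)
  have h: "set_integrable lborel {0..ubar} h"
    using g cont unfolding h_def type_density_def
    by (intro borel_integrable_atLeastAtMost' continuous_on_mult) auto
  have h_pos: "0 < h u" if "0 < u" "u \<le> ubar" "u < w" for u
    using pos[OF that] g_pos[of u] that by (simp add: h_def)
  have h_neg: "h u < 0" if "w < u" "u \<le> ubar" for u
    using neg[OF that] g_pos[of u] that w by (simp add: h_def mult_pos_neg)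
  have W: "welfare abar ubar f g v t a' = (LINT u:{0..ubar}|lborel. a' 0 u * h u)"
    if "feasible abar ubar f g \<infinity> a' c'" for a' c'
    using welfare_feasible_infinity[OF that] by (simp add: h_def \<phi>_def)
  \<comment> \<open>The type \<open>\<alpha> = 0\<close> represents all others;
    \<open>0 < abar\<close> places it in the type interval.\<close>
  have range: "\<And>u. u \<in> {0..ubar} \<Longrightarrow> a' 0 u \<in> {0..1}"
    and anti: "antimono_on {0..ubar} (a' 0)"
    if "feasible abar ubar f g \<infinity> a' c'" for a' c'
    using that \<open>0 < abar\<close> by (auto simp: feasible_def monotone_on_def)
  have thr: "feasible abar ubar f g \<infinity> (threshold_rule w) (\<lambda>_ _. 0)"
    using f g by (rule feasible_threshold_rule)
  have W_thr: "welfare abar ubar f g v t (threshold_rule w)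
      = (LINT u:{0..ubar}|lborel. (if u < w then 1 else 0) * h u)"
    using W[OF thr] by (simp add: threshold_rule_def)
  have a: "feasible abar ubar f g \<infinity> a c"
    and "welfare abar ubar f g v t (threshold_rule w) \<le> welfare abar ubar f g v t a"
    using opt thr by (auto simp: optimal_def)
  then have *: "(u < w \<and> u \<noteq> ubar \<longrightarrow> a 0 u = 1) \<and> (u > w \<longrightarrow> a 0 u = 0)"
    if "u \<in> {0..ubar}" for u
    using bang_bang_unique[OF h h_pos h_neg w range[OF a] anti[OF a] _ that]
    by (simp add: W_thr W[OF a])
  have "follows_threshold abar ubar w a"
    unfolding follows_threshold_def
  proof (intro ballI)
    fix \<alpha> u assume "\<alpha> \<in> {0..abar}" "u \<in> {0..ubar}"
    then show "(u < w \<and> u \<noteq> ubar \<longrightarrow> a \<alpha> u = 1) \<and> (u > w \<longrightarrow> a \<alpha> u = 0)"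
      using feasible_infinity_eq[OF a, of \<alpha> u] *[of u] by simp
  qed
  moreover have "welfare abar ubar f g v t a' \<le> welfare abar ubar f g v t (threshold_rule w)"
    if "feasible abar ubar f g \<infinity> a' c'" for a' c'
    using bang_bang_le[OF h h_pos h_neg w range[OF that] anti[OF that]]
    by (simp add: W_thr W[OF that])
  ultimately show ?thesis
    using thr by (auto simp: optimal_def)
qed

section \<open>The law of a type, its c.d.f. and its truncated mean\<close>

lemma sets_law [simp, measurable_cong]: "sets (law f) = sets borel"
  and space_law [simp]: "space (law f) = UNIV"
  by (simp_all add: law_def)

lemma prob_space_law: "type_density b f \<Longrightarrow> prob_space (law f)"
  by (simp add: type_density_def)

lemma integral_law:
  fixes X :: "real \<Rightarrow> real"
  assumes f: "type_density b f" and X: "X \<in> borel_measurable borel"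
  shows "(LINT x|law f. X x) = (LINT x:{0..b}|lborel. f x * X x)"
proof -
  have "(LINT x|law f. X x) = (LINT x|lborel. f x * X x)"
    unfolding law_def using X type_density_measurable[OF f] type_density_nonneg[OF f]
    by (subst integral_density) auto
  also have "\<dots> = (LINT x:{0..b}|lborel. f x * X x)"
    unfolding set_lebesgue_integral_def using f
    by (intro Bochner_Integration.integral_cong) (auto simp: type_density_def indicator_def)
  finally show ?thesis .
qed

text \<open>\<open>f\<close> is positive exactly on \<open>{0..b}\<close>, so there the law and
  Lebesgue measure have the same null sets.\<close>

lemma AE_law_iff:
  assumes "type_density b f"
  shows "(AE x in law f. P x) \<longleftrightarrow> (AE x in lborel. x \<in> {0..b} \<longrightarrow> P x)"
proof -
  have "(AE x in law f. P x) \<longleftrightarrow> (AE x in lborel. 0 < f x \<longrightarrow> P x)"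
    unfolding law_def using type_density_measurable[OF assms] by (subst AE_density) auto
  moreover have "0 < f x \<longleftrightarrow> x \<in> {0..b}" for x
    using assms by (cases "x \<in> {0..b}") (auto simp: type_density_def)
  ultimately show ?thesis by simp
qed

text \<open>Otherwise almost no point would lie in the interval from \<open>0\<close> to
  \<open>min b v\<close>. This mass is the denominator in \<open>mean_below\<close>.\<close>

lemma measure_law_lessThan_pos:
  assumes f: "type_density b f" and "0 < b" and "0 < v"
  shows "0 < measure (law f) {..<v}"
proof (rule ccontr)
  interpret prob_space "law f" using f by (rule prob_space_law)
  assume "\<not> 0 < measure (law f) {..<v}"
  then have "prob {..<v} = 0"
    using measure_nonneg[of "law f" "{..<v}"] by linarith
  then have "AE x in law f. x \<notin> {..<v}"
    by (subst (asm) prob_eq_0) auto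
  then have "AE x in lborel. x \<in> {0..b} \<longrightarrow> \<not> x < v"
    by (simp add: AE_law_iff[OF f])
  then obtain z where "0 < z" "z < min b v" "z \<in> {0..b} \<longrightarrow> \<not> z < v"
    by (rule AE_lborel_obtain_Ioo[of _ 0 "min b v"]) (use assms in auto)
  then show False by auto
qed

text \<open>The law has no atoms. This reconciles the closed half-line in \<open>cdf\<close> with
  the open one in \<open>mean_below\<close>.\<close>

lemma cdf_law_eq_lessThan:
  assumes "type_density b f"
  shows "cdf (law f) v = measure (law f) {..<v}"
proof -
  interpret prob_space "law f" using assms by (rule prob_space_law)
  have "AE x in law f. x \<noteq> v"
    using AE_lborel_singleton[of v] by (auto simp: AE_law_iff[OF assms] elim: eventually_mono)
  then show ?thesis
    unfolding cdf_def by (intro finite_measure_eq_AE) (auto elim: eventually_mono)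
qed

lemma integrable_law_min:
  assumes f: "type_density b f" and "0 \<le> v"
  shows "integrable (law f) (min v)"
proof -
  interpret prob_space "law f" using f by (rule prob_space_law)
  show ?thesis
  proof (rule integrable_const_bound)
    show "AE \<alpha> in law f. norm (min v \<alpha>) \<le> v"
      unfolding AE_law_iff[OF f] using \<open>0 \<le> v\<close> by (intro AE_I2) auto
  qed measurable
qed

text \<open>Fubini for the indicator of \<open>S\<close>: integrating over \<open>\<alpha>\<close>
  first gives the c.d.f. at \<open>x\<close>, integrating over \<open>x\<close> first gives the
  length of \<open>{\<alpha>..v}\<close>.\<close>

lemma integral_cdf_law:
  assumes f: "type_density b f" and "0 \<le> v"
  shows "(LINT x:{0..v}|lborel. cdf (law f) x) = v - (LINT \<alpha>|law f. min v \<alpha>)"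
proof -
  interpret prob_space "law f" using f by (rule prob_space_law)
  interpret P: pair_sigma_finite "law f" lborel ..
  define S :: "(real \<times> real) set" where "S = {(\<alpha>, x). 0 \<le> x \<and> x \<le> v \<and> \<alpha> \<le> x}"
  have S [measurable]: "S \<in> sets (borel \<Otimes>\<^sub>M borel)"
    unfolding borel_prod S_def case_prod_beta
    by (intro borel_closed closed_Collect_conj closed_Collect_le continuous_intros)
  \<comment> \<open>\<open>S\<close> lies in a strip of measure \<open>v\<close>, so its indicator
    is integrable and Fubini applies.\<close>
  have "emeasure (law f \<Otimes>\<^sub>M lborel) S \<le> emeasure (law f \<Otimes>\<^sub>M lborel) (UNIV \<times> {0..v})"
    by (intro emeasure_mono) (auto simp: S_def)
  also have "\<dots> < \<infinity>"
    using \<open>0 \<le> v\<close> emeasure_space_1 by (subst lborel.emeasure_pair_measure_Times) auto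
  finally have "integrable (law f \<Otimes>\<^sub>M lborel) (indicator S :: _ \<Rightarrow> real)"
    by (intro integrable_real_indicator) auto
  then have "(LINT x|lborel. LINT \<alpha>|law f. indicator S (\<alpha>, x))
      = (LINT \<alpha>|law f. LINT x|lborel. indicator S (\<alpha>, x) :: real)"
    by (intro P.Fubini_integral) auto
  also have "(LINT x|lborel. LINT \<alpha>|law f. indicator S (\<alpha>, x))
      = (LINT x:{0..v}|lborel. cdf (law f) x)"
    unfolding set_lebesgue_integral_def
  proof (intro Bochner_Integration.integral_cong refl)
    fix x :: real
    have "(LINT \<alpha>|law f. indicator S (\<alpha>, x))
        = (LINT \<alpha>|law f. indicator {0..v} x * indicator {..x} \<alpha> :: real)"
      by (intro Bochner_Integration.integral_cong) (auto simp: S_def indicator_def)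
    then show "(LINT \<alpha>|law f. indicator S (\<alpha>, x)) = indicator {0..v} x *\<^sub>R cdf (law f) x"
      by (simp add: cdf_def)
  qed
  also have "(LINT \<alpha>|law f. LINT x|lborel. indicator S (\<alpha>, x) :: real)
      = (LINT \<alpha>|law f. v - min v \<alpha>)"
  proof (intro integral_cong_AE)
    \<comment> \<open>Almost surely \<open>0 \<le> \<alpha>\<close>, so the section of
      \<open>S\<close> is \<open>{\<alpha>..v}\<close>. It is empty if \<open>\<alpha> > v\<close>,
      in agreement with \<open>v - min v \<alpha> = 0\<close>.\<close>
    show "AE \<alpha> in law f. (LINT x|lborel. indicator S (\<alpha>, x)) = v - min v \<alpha>"
      unfolding AE_law_iff[OF f]
    proof (intro AE_I2 impI)
      fix \<alpha> assume "\<alpha> \<in> {0..b}"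
      then have "(LINT x|lborel. indicator S (\<alpha>, x)) = (LINT x|lborel. indicator {\<alpha>..v} x :: real)"
        by (intro Bochner_Integration.integral_cong) (auto simp: S_def indicator_def)
      then show "(LINT x|lborel. indicator S (\<alpha>, x)) = v - min v \<alpha>"
        by (simp add: min_def measure_def emeasure_lborel_Icc_eq)
    qed
  qed measurable
  also have "\<dots> = v - (LINT \<alpha>|law f. min v \<alpha>)"
    using integrable_law_min[OF f \<open>0 \<le> v\<close>] prob_space by simp
  finally show ?thesis .
qed

text \<open>Split at \<open>v\<close>: types below \<open>v\<close> contribute the conditional mean
  times their probability, and all others contribute \<open>v\<close>.\<close>

lemma integral_min_law_mean_below:
  assumes f: "type_density b f" and "0 < b" and "0 < v"
  shows "(LINT \<alpha>|law f. min v \<alpha>) = v * (1 - cdf (law f) v) + mean_below f v * cdf (law f) v"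
proof -
  interpret prob_space "law f" using f by (rule prob_space_law)
  let ?p = "prob {..<v}"
  have p: "0 < ?p" using assms by (rule measure_law_lessThan_pos)
  have bounded: "AE \<alpha> in law f. norm (indicator {..<v} \<alpha> * \<alpha>) \<le> b"
    using \<open>0 < b\<close> by (auto simp: AE_law_iff[OF f] indicator_def)
  have int: "integrable (law f) (\<lambda>\<alpha>. indicator {..<v} \<alpha> * \<alpha>)"
    by (rule integrable_const_bound[OF bounded]) measurable
  have "mean_below f v = (LINT \<alpha>|law f. (indicator {..<v} \<alpha> / ?p) *\<^sub>R \<alpha>)"
  proof -
    \<comment> \<open>Conditioning on \<open>\<alpha> < v\<close> is written with a real-valued
      density, the form to which \<open>integral_density\<close> applies.\<close>
    have "uniform_measure (law f) {..<v} = density (law f) (\<lambda>\<alpha>. ennreal (indicator {..<v} \<alpha> / ?p))"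
      unfolding uniform_measure_def using p
      by (intro density_cong AE_I2) (auto simp: emeasure_eq_measure divide_ennreal indicator_def simp flip: ennreal_1)
    then show ?thesis
      unfolding mean_below_def by (subst integral_density[symmetric]) auto
  qed
  also have "\<dots> = (LINT \<alpha>|law f. indicator {..<v} \<alpha> * \<alpha>) / ?p"
    by (subst integral_divide_zero[symmetric]) (simp add: mult_ac)
  finally have "(LINT \<alpha>|law f. indicator {..<v} \<alpha> * \<alpha>) = mean_below f v * ?p"
    using p by (simp add: field_simps)
  moreover have "(LINT \<alpha>|law f. min v \<alpha>)
      = (LINT \<alpha>|law f. indicator {..<v} \<alpha> * \<alpha> + (v - v * indicator {..<v} \<alpha>))"
    by (intro Bochner_Integration.integral_cong) (auto simp: indicator_def min_def)
  moreover have "\<dots> = (LINT \<alpha>|law f. indicator {..<v} \<alpha> * \<alpha>) + (v - v * ?p)"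
    using int prob_space by (simp add: emeasure_eq_measure)
  ultimately show ?thesis
    by (simp add: cdf_law_eq_lessThan[OF f] algebra_simps)
qed

section \<open>The surplus for uniform densities and its sign\<close>

text \<open>The minimum switches from \<open>\<alpha> * u\<close> to \<open>v\<close> at
  \<open>\<alpha> = v / u\<close>, which the last hypothesis places in \<open>{0..A}\<close>. The
  area is a triangle plus a rectangle.\<close>

lemma has_integral_min_mult:
  fixes u v A :: real
  assumes "0 < u" and "0 < v" and "v \<le> A * u"
  shows "((\<lambda>\<alpha>. min v (\<alpha> * u)) has_integral (A * v - v\<^sup>2 / (2 * u))) {0..A}"
proof -
  have 1: "((\<lambda>\<alpha>. min v (\<alpha> * u)) has_integral (v\<^sup>2 / (2 * u))) {0..v / u}"
  proof -
    have "((\<lambda>\<alpha>. \<alpha> * u) has_integral ((v / u)\<^sup>2 * u / 2 - 0\<^sup>2 * u / 2)) {0..v / u}"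
      using assms by (intro fundamental_theorem_of_calculus)
        (auto intro!: derivative_eq_intros simp flip: has_real_derivative_iff_has_vector_derivative)
    also have "(v / u)\<^sup>2 * u / 2 - 0\<^sup>2 * u / 2 = v\<^sup>2 / (2 * u)"
      using assms by (simp add: power2_eq_square field_simps)
    finally show ?thesis
      by (rule has_integral_eq[rotated]) (use assms in \<open>auto simp: field_simps\<close>)
  qed
  have 2: "((\<lambda>\<alpha>. min v (\<alpha> * u)) has_integral (v * (A - v / u))) {v / u..A}"
  proof (rule has_integral_eq)
    show "((\<lambda>\<alpha>. v) has_integral (v * (A - v / u))) {v / u..A}"
      using has_integral_const_real[of v "v / u" A] assms by (simp add: field_simps)
  qed (use assms in \<open>auto simp: field_simps\<close>)
  have "v\<^sup>2 / (2 * u) + v * (A - v / u) = A * v - v\<^sup>2 / (2 * u)"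
    using assms by (simp add: power2_eq_square field_simps)
  then show ?thesis
    using has_integral_combine[OF _ _ 1 2] assms by (simp add: field_simps)
qed

text \<open>The \<open>min\<close> and \<open>max\<close> merge two regimes. For
  \<open>u \<le> v / A\<close> the cap \<open>v\<close> never binds, the two middle terms cancel and
  \<open>A * u / 2 - u\<close> remains; for larger \<open>u\<close> the cap binds from
  \<open>\<alpha> = v / u\<close> on. This form is continuous also at \<open>u = 0\<close>, since
  the denominator stays positive.\<close>

lemma uniform_surplus:
  fixes A u v :: real
  assumes "0 < A" and "0 < v" and "0 \<le> u"
  shows "(LINT \<alpha>:{0..A}|lborel. 1 / A * (min v (\<alpha> * u) - u))
    = A / 2 * min u (v / A) + v / 2 - v\<^sup>2 / (2 * A * max u (v / A)) - u"
proof -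
  have "set_integrable lborel {0..A} (\<lambda>\<alpha>. 1 / A * (min v (\<alpha> * u) - u))"
    by (intro borel_integrable_atLeastAtMost' continuous_intros)
  then have "(LINT \<alpha>:{0..A}|lborel. 1 / A * (min v (\<alpha> * u) - u))
      = integral {0..A} (\<lambda>\<alpha>. 1 / A * (min v (\<alpha> * u) - u))"
    by (rule set_borel_integral_eq_integral)
  also have "\<dots> = A / 2 * min u (v / A) + v / 2 - v\<^sup>2 / (2 * A * max u (v / A)) - u"
  proof (rule integral_unique)
    have const: "((\<lambda>\<alpha>. u) has_integral (A * u)) {0..A}"
      using has_integral_const_real[of u 0 A] assms by simp
    show "((\<lambda>\<alpha>. 1 / A * (min v (\<alpha> * u) - u)) has_integral
        A / 2 * min u (v / A) + v / 2 - v\<^sup>2 / (2 * A * max u (v / A)) - u) {0..A}"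
    proof (cases "u \<le> v / A")
      case True
      have "((\<lambda>\<alpha>. \<alpha> * u) has_integral (A\<^sup>2 * u / 2 - 0\<^sup>2 * u / 2)) {0..A}"
        using assms by (intro fundamental_theorem_of_calculus)
          (auto intro!: derivative_eq_intros simp flip: has_real_derivative_iff_has_vector_derivative)
      then have "((\<lambda>\<alpha>. min v (\<alpha> * u)) has_integral (A\<^sup>2 * u / 2 - 0\<^sup>2 * u / 2)) {0..A}"
      proof (rule has_integral_eq[rotated])
        fix \<alpha> assume "\<alpha> \<in> {0..A}"
        then have "\<alpha> * u \<le> A * (v / A)"
          using True assms by (intro mult_mono) auto
        then show "\<alpha> * u = min v (\<alpha> * u)"
          using assms by simp
      qed
      from has_integral_mult_right[OF has_integral_diff[OF this const], of "1 / A"]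
      show ?thesis
        by (rule has_integral_eq_rhs)
          (use True assms in \<open>simp add: power2_eq_square field_simps\<close>)
    next
      case False
      then have u: "0 < u" "v \<le> A * u"
        using assms by (auto simp: field_simps intro: le_less_trans[of 0 "v / A"])
      from has_integral_mult_right[OF has_integral_diff[OF has_integral_min_mult[OF u(1) \<open>0 < v\<close> u(2)] const], of "1 / A"]
      show ?thesis
        by (rule has_integral_eq_rhs)
          (use False assms u in \<open>simp add: power2_eq_square field_simps\<close>)
    qed
  qed
  finally show ?thesis .
qed

text \<open>Multiplied by \<open>- u\<close>, the left-hand side is the quadratic
  \<open>u\<^sup>2 - v * u + v\<^sup>2 / (2 * A)\<close>, whose discriminant is
  \<open>v\<^sup>2 * (1 - 2 / A)\<close>.\<close>

lemma surplus_quadratic_factor: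
  fixes A u v :: real
  assumes "2 < A" and "u \<noteq> 0"
  shows "v - v\<^sup>2 / (2 * A * u) - u
    = (u - v / 2 * (1 - sqrt (1 - 2 / A))) * (v / 2 * (1 + sqrt (1 - 2 / A)) - u) / u"
proof -
  define s where "s = sqrt (1 - 2 / A)"
  have s: "s * s = 1 - 2 / A"
    using assms by (simp add: s_def)
  have "(u - v / 2 * (1 - s)) * (v / 2 * (1 + s) - u) = u * v - u * u - v\<^sup>2 / 4 * (1 - s * s)"
    by (simp add: field_simps power2_eq_square)
  also have "\<dots> = u * v - u * u - v\<^sup>2 / (2 * A)"
    using assms by (simp add: s field_simps)
  finally show ?thesis
    using assms by (simp add: s_def field_simps power2_eq_square)
qed

text \<open>The switching point \<open>v / A\<close> lies strictly between the two roots of the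
  quadratic that governs larger \<open>u\<close>, so only the larger root \<open>w\<close> is a sign
  change.\<close>

lemma uniform_surplus_sign:
  fixes A u v :: real
  defines "\<phi> \<equiv> A / 2 * min u (v / A) + v / 2 - v\<^sup>2 / (2 * A * max u (v / A)) - u"
    and "w \<equiv> v / 2 * (1 + sqrt (1 - 2 / A))"
  assumes "2 < A" and "0 < v"
  shows "0 < u \<Longrightarrow> u < w \<Longrightarrow> 0 < \<phi>" and "w < u \<Longrightarrow> \<phi> < 0"
proof -
  define s where "s = sqrt (1 - 2 / A)"
  have s: "0 < s" "s < 1" "s * s = 1 - 2 / A"
    using assms(3) by (auto simp: s_def)
  \<comment> \<open>The product on the right is \<open>2 / A\<close>; scaling by
    \<open>v / 2\<close> puts the smaller root below \<open>v / A\<close>.\<close>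
  have "(1 - s) * 1 < (1 - s) * (1 + s)"
    using s by (intro mult_strict_left_mono) auto
  also have "(1 - s) * (1 + s) = 2 / A"
    using s(3) by (simp add: algebra_simps)
  finally have "v / 2 * (1 - s) < v / 2 * (2 / A)"
    using \<open>0 < v\<close> by (intro mult_strict_left_mono) auto
  then have low: "v / 2 * (1 - s) < v / A"
    by simp
  have "v / A < v / 2"
    using assms by (simp add: field_simps)
  also have "v / 2 < w"
    using s(1) \<open>0 < v\<close> by (simp add: w_def flip: s_def)
  finally have high: "v / A < w" .
  have large: "\<phi> = (u - v / 2 * (1 - s)) * (w - u) / u" if "v / A < u"
  proof -
    have "\<phi> = v - v\<^sup>2 / (2 * A * u) - u"
      using that assms by (simp add: \<phi>_def min_def max_def)
    moreover have "u \<noteq> 0"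
      using that assms by (auto simp: field_simps)
    ultimately show ?thesis
      using surplus_quadratic_factor[OF \<open>2 < A\<close>, of u v] by (simp add: s_def w_def)
  qed
  have v_A: "0 < v / A"
    using assms by simp
  show "0 < \<phi>" if "0 < u" "u < w"
  proof (cases "u \<le> v / A")
    case True
    then have "\<phi> = u * (A / 2 - 1)"
      using assms by (simp add: \<phi>_def min_def max_def field_simps power2_eq_square)
    then show ?thesis
      using that assms by simp
  next
    case False
    then have "0 < u - v / 2 * (1 - s)"
      using low by linarith
    then show ?thesis
      using large False that by simp
  qed
  show "\<phi> < 0" if "w < u"
  proof -
    have "0 < u - v / 2 * (1 - s)" "0 < u" "v / A < u"
      using that high low v_A by linarith+
    then show ?thesis
      using large that by (simp add: mult_pos_neg divide_neg_pos)
  qed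
qed

section \<open>The additive and the multiplicative specification of \<open>t\<close>\<close>

theorem lemma4:
  fixes abar ubar v :: real
    and f g F G :: "real \<Rightarrow> real"
    and t a c :: "real \<Rightarrow> real \<Rightarrow> real"
  assumes "abar > 0" and "ubar > 0" and "v > 0"
    and "type_density abar f" and "type_density ubar g"
    and "F = cdf (law f)" and "G = cdf (law g)"
    and "antimono_on {0..ubar} (\<lambda>u. (1 - G u) / g u - u)"
    and "optimal abar ubar f g v t \<infinity> a c"
  shows "((\<forall>\<alpha>\<in>{0..abar}. \<forall>u\<in>{0..ubar}. t \<alpha> u = \<alpha>) \<longrightarrow>
           (\<exists>u_inf \<le> v.
              follows_threshold abar ubar u_inf a \<and>
              optimal abar ubar f g v t \<infinity> (threshold_rule u_inf) (\<lambda>_ _. 0) \<and>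
              u_inf = v - (LINT \<alpha>:{0..v}|lborel. F \<alpha>) \<and>
              u_inf = v * (1 - F v) + mean_below f v * F v))
       \<and> ((\<forall>\<alpha>\<in>{0..abar}. \<forall>u\<in>{0..ubar}. t \<alpha> u = \<alpha> * u) \<and>
           (\<forall>\<alpha>\<in>{0..abar}. f \<alpha> = 1 / abar) \<and> (\<forall>u\<in>{0..ubar}. g u = 1 / ubar) \<and> abar > 2 \<longrightarrow>
           (let u_inf = v / 2 * (1 + sqrt (1 - 2 / abar)) in
              follows_threshold abar ubar u_inf a \<and>
              optimal abar ubar f g v t \<infinity> (threshold_rule u_inf) (\<lambda>_ _. 0)))"
proof -
  note f = \<open>type_density abar f\<close> and g = \<open>type_density ubar g\<close>
    and opt = \<open>optimal abar ubar f g v t \<infinity> a c\<close>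
  interpret prob_space "law f" using f by (rule prob_space_law)
  define \<phi> where "\<phi> u = (LINT \<alpha>:{0..abar}|lborel. f \<alpha> * (min v (t \<alpha> u) - u))" for u
  note threshold = optimal_threshold[OF \<open>abar > 0\<close> f g opt, folded \<phi>_def]
  have part1: "\<exists>u_inf \<le> v.
      follows_threshold abar ubar u_inf a \<and>
      optimal abar ubar f g v t \<infinity> (threshold_rule u_inf) (\<lambda>_ _. 0) \<and>
      u_inf = v - (LINT \<alpha>:{0..v}|lborel. F \<alpha>) \<and>
      u_inf = v * (1 - F v) + mean_below f v * F v"
    if t: "\<forall>\<alpha>\<in>{0..abar}. \<forall>u\<in>{0..ubar}. t \<alpha> u = \<alpha>"
  \<comment> \<open>The witness is the zero of \<open>\<phi> u = E[min v \<alpha>] - u\<close>; the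
    two displayed formulas are two evaluations of this expectation.\<close>
  proof (rule exI[of _ "LINT \<alpha>|law f. min v \<alpha>"])
    let ?m = "LINT \<alpha>|law f. min v \<alpha>"
    have m_integral: "?m = v - (LINT \<alpha>:{0..v}|lborel. F \<alpha>)"
      using integral_cdf_law[OF f, of v] assms by simp
    have "0 \<le> (LINT \<alpha>:{0..v}|lborel. F \<alpha>)"
      unfolding set_lebesgue_integral_def \<open>F = _\<close> cdf_def
      by (intro integral_nonneg_AE AE_I2) auto
    then have "?m \<le> v" using m_integral by simp
    have "AE \<alpha> in law f. 0 \<le> min v \<alpha>"
      unfolding AE_law_iff[OF f] using \<open>v > 0\<close> by (intro AE_I2) auto
    then have "0 \<le> ?m" by (rule integral_nonneg_AE)
    have phi: "\<phi> u = ?m - u" if u: "u \<in> {0..ubar}" for u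
    proof -
      have "\<phi> u = (LINT \<alpha>:{0..abar}|lborel. f \<alpha> * (min v \<alpha> - u))"
        unfolding \<phi>_def using t u by (intro set_lebesgue_integral_cong) auto
      also have "\<dots> = (LINT \<alpha>|law f. min v \<alpha> - u)"
        by (rule integral_law[OF f, symmetric]) measurable
      also have "\<dots> = ?m - u"
        using integrable_law_min[OF f, of v] \<open>v > 0\<close> prob_space by simp
      finally show ?thesis .
    qed
    have "continuous_on {0..ubar} (\<lambda>u. ?m - u)"
      by (intro continuous_intros)
    \<comment> \<open>\<open>t\<close> is prescribed on the type rectangle only, so continuity is
      transferred from the explicit formula on \<open>{0..ubar}\<close>.\<close>
    then have cont: "continuous_on {0..ubar} \<phi>"
      by (rule continuous_on_eq) (simp add: phi)
    have "follows_threshold abar ubar ?m a \<and>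
        optimal abar ubar f g v t \<infinity> (threshold_rule ?m) (\<lambda>_ _. 0)"
      using \<open>0 \<le> ?m\<close> cont by (rule threshold) (use \<open>0 \<le> ?m\<close> in \<open>simp_all add: phi\<close>)
    then show "?m \<le> v \<and> follows_threshold abar ubar ?m a \<and>
        optimal abar ubar f g v t \<infinity> (threshold_rule ?m) (\<lambda>_ _. 0) \<and>
        ?m = v - (LINT \<alpha>:{0..v}|lborel. F \<alpha>) \<and>
        ?m = v * (1 - F v) + mean_below f v * F v"
      using \<open>?m \<le> v\<close> m_integral integral_min_law_mean_below[OF f \<open>abar > 0\<close> \<open>v > 0\<close>]
      unfolding \<open>F = _\<close> by blast
  qed
  have part2: "let u_inf = v / 2 * (1 + sqrt (1 - 2 / abar)) in
      follows_threshold abar ubar u_inf a \<and>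
      optimal abar ubar f g v t \<infinity> (threshold_rule u_inf) (\<lambda>_ _. 0)"
    if t: "\<forall>\<alpha>\<in>{0..abar}. \<forall>u\<in>{0..ubar}. t \<alpha> u = \<alpha> * u"
      and unif: "\<forall>\<alpha>\<in>{0..abar}. f \<alpha> = 1 / abar" and "abar > 2"
  proof -
    let ?w = "v / 2 * (1 + sqrt (1 - 2 / abar))"
    let ?\<psi> = "\<lambda>u. abar / 2 * min u (v / abar) + v / 2 - v\<^sup>2 / (2 * abar * max u (v / abar)) - u"
    have "0 \<le> ?w"
      using \<open>v > 0\<close> \<open>abar > 2\<close> by simp
    have phi: "\<phi> u = ?\<psi> u" if u: "u \<in> {0..ubar}" for u
    proof -
      have "\<phi> u = (LINT \<alpha>:{0..abar}|lborel. 1 / abar * (min v (\<alpha> * u) - u))"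
        unfolding \<phi>_def using t unif u by (intro set_lebesgue_integral_cong) auto
      then show ?thesis
        using uniform_surplus[of abar v u] u assms by simp
    qed
    \<comment> \<open>The explicit surplus has no pole, not even at \<open>u = 0\<close>, hence it
      is continuous on all of \<open>{0..ubar}\<close>.\<close>
    have "0 < max u (v / abar)" for u
      using \<open>abar > 0\<close> \<open>v > 0\<close> by (simp add: less_max_iff_disj)
    then have "2 * abar * max u (v / abar) \<noteq> 0" for u
      using \<open>abar > 0\<close> by (simp add: less_imp_neq[symmetric])
    then have "continuous_on {0..ubar} ?\<psi>"
      by (intro continuous_intros) auto
    then have cont: "continuous_on {0..ubar} \<phi>"
      by (rule continuous_on_eq) (simp add: phi)
    show ?thesis
      unfolding Let_def using \<open>0 \<le> ?w\<close> cont
    proof (rule threshold)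
      show "0 < \<phi> u" if "0 < u" "u \<le> ubar" "u < ?w" for u
        using uniform_surplus_sign(1)[OF \<open>abar > 2\<close> \<open>v > 0\<close>] phi that by simp
      show "\<phi> u < 0" if "?w < u" "u \<le> ubar" for u
        using uniform_surplus_sign(2)[OF \<open>abar > 2\<close> \<open>v > 0\<close> that(1)] phi[of u] that \<open>0 \<le> ?w\<close>
        by simp
    qed
  qed
  show ?thesis
    using part1 part2 by blast
qed

end
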